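(* For all positive integers $n$ and $k$, $$c_1\left(K_{2,n}^{\oslash k}\right) \;\leq\; 2 - \frac{2}{2\lceil n/2 \rceil + 1}.$$
   Context: An $s$-$t$ graph is a graph $G$ with two distinguished vertices $s(G), t(G)$. Graphs carry edge lengths $\mathrm{len}$ and are viewed as metric spaces with the shortest-path metric. For $s$-$t$ graphs $H,G$ with edge lengths, $H \oslash G$ is the $s$-$t$ graph obtained by replacing each edge $e=(u,v)$ of $H$ by a new copy of $G$, with $s(G)$ identified with $u$ and $t(G)$ identified with $v$ (with respect to an arbitrary fixed orientation of the edges of $H$; for $G=K_{2,n}$ the orientation is irrelevant by symmetry). The edges of the copy of $G$ replacing $e$ have their $G$-lengths multiplied by $\mathrm{len}_H(e)/d_G(s(G),t(G))$, and $s(H\oslash G)=s(H)$, $t(H \oslash G)=t(H)$. $G^{\oslash 0}$ is a single edge of unit length (its endpoints being $s$ and $t$), and $G^{\oslash k} = G^{\oslash (k-1)} \oslash G$ for $k \ge 1$. $K_{2,n}$ is the complete bipartite graph with $2$ vertices on one side and $n$ on the other, with unit edge lengths; it is an $s$-$t$ graph whose vertices $s,t$ are the two vertices of the side of size 2. For a map $f:(X,d_X)\to(Y,d_Y)$ between metric spaces, $\|f\|_{\mathrm{Lip}} = \sup_{x\ne y} d_Y(f(x),f(y))/d_X(x,y)$, and for injective $f$ the distortion is $\mathrm{dist}(f)=\|f\|_{\mathrm{Lip}}\cdot\|f^{-1}\|_{\mathrm{Lip}}$ (and $\infty$ if $f$ is not injective). For a metric space $X$, $c_1(X)$ is the least distortion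 (infimum of $\mathrm{dist}(f)$) over maps $f: X\to L_1$. Here $c_1(K_{2,n}^{\oslash k})$ refers to the shortest-path metric on $V(K_{2,n}^{\oslash k})$ in which every edge of $K_{2,n}^{\oslash k}$ has length $2^{-k}$ (these are the lengths produced by the recursive definition of $K_{2,n}^{\oslash k}$, since $d_{K_{2,n}}(s,t)=2$). *)

theory Defs
  imports "HOL-Analysis.Analysis"
begin

abbreviation unit_leb :: "real measure" where
  "unit_leb \<equiv> lebesgue_on {0..1}"

definition L1_rel :: "(real \<Rightarrow> real) \<Rightarrow> (real \<Rightarrow> real) \<Rightarrow> bool" where
  "L1_rel f g \<longleftrightarrow> integrable unit_leb f \<and> integrable unit_leb g \<and> (AE x in unit_leb. f x = g x)"

quotient_type L1 = "real \<Rightarrow> real" / partial: L1_rel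
proof (rule part_equivpI)
  show "\<exists>f. L1_rel f f"
    by (rule exI[of _ "\<lambda>_. 0"]) (simp add: L1_rel_def)
  show "symp L1_rel"
    by (rule sympI) (auto simp: L1_rel_def elim: eventually_mono)
  show "transp L1_rel"
  proof (rule transpI)
    fix f g h assume "L1_rel f g" "L1_rel g h"
    then show "L1_rel f h"
      unfolding L1_rel_def by (auto elim: eventually_elim2)
  qed
qed

instantiation L1 :: metric_space
begin

lift_definition dist_L1 :: "L1 \<Rightarrow> L1 \<Rightarrow> real" is
  "\<lambda>f g. \<integral>x. \<bar>f x - g x\<bar> \<partial>unit_leb"
proof -
  fix f f' g g' assume "L1_rel f f'" "L1_rel g g'"
  then have int: "integrable unit_leb f" "integrable unit_leb f'"
      "integrable unit_leb g" "integrable unit_leb g'"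
    and ae: "AE x in unit_leb. f x = f' x" "AE x in unit_leb. g x = g' x"
    by (auto simp: L1_rel_def)
  show "(\<integral>x. \<bar>f x - g x\<bar> \<partial>unit_leb) = (\<integral>x. \<bar>f' x - g' x\<bar> \<partial>unit_leb)"
  proof (rule integral_cong_AE)
    show "(\<lambda>x. \<bar>f x - g x\<bar>) \<in> borel_measurable unit_leb"
      using int by (intro borel_measurable_integrable integrable_abs Bochner_Integration.integrable_diff)
    show "(\<lambda>x. \<bar>f' x - g' x\<bar>) \<in> borel_measurable unit_leb"
      using int by (intro borel_measurable_integrable integrable_abs Bochner_Integration.integrable_diff)
    show "AE x in unit_leb. \<bar>f x - g x\<bar> = \<bar>f' x - g' x\<bar>"
      using ae by eventually_elim simp
  qed
qed

definition uniformity_L1 :: "(L1 \<times> L1) filter" where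
  "uniformity_L1 = (INF e\<in>{0 <..}. principal {(x, y). dist x y < e})"

definition open_L1 :: "L1 set \<Rightarrow> bool" where
  "open_L1 U \<longleftrightarrow> (\<forall>x\<in>U. eventually (\<lambda>(x', y). x' = x \<longrightarrow> y \<in> U) uniformity)"

instance
proof
  show "(uniformity :: (L1 \<times> L1) filter) = (INF e\<in>{0 <..}. principal {(x, y). dist x y < e})"
    by (fact uniformity_L1_def)
  show "open U \<longleftrightarrow> (\<forall>x\<in>U. eventually (\<lambda>(x', y). x' = x \<longrightarrow> y \<in> U) uniformity)" for U :: "L1 set"
    by (fact open_L1_def)
  show "dist x y = 0 \<longleftrightarrow> x = y" for x y :: L1
  proof transfer
    fix f g assume "L1_rel f f" "L1_rel g g"
    then have int: "integrable unit_leb f" "integrable unit_leb g"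
      by (auto simp: L1_rel_def)
    then have "integrable unit_leb (\<lambda>x. \<bar>f x - g x\<bar>)"
      by (intro integrable_abs Bochner_Integration.integrable_diff)
    from integral_nonneg_eq_0_iff_AE[OF this]
    show "((\<integral>x. \<bar>f x - g x\<bar> \<partial>unit_leb) = 0) = L1_rel f g"
      using int by (simp add: L1_rel_def)
  qed
  show "dist x y \<le> dist x z + dist y z" for x y z :: L1
  proof transfer
    fix f g h assume "L1_rel f f" "L1_rel g g" "L1_rel h h"
    then have int: "integrable unit_leb f" "integrable unit_leb g" "integrable unit_leb h"
      by (auto simp: L1_rel_def)
    have I: "integrable unit_leb (\<lambda>x. \<bar>u x - v x\<bar>)"
      if "integrable unit_leb u" "integrable unit_leb v" for u v :: "real \<Rightarrow> real"
      using that by (intro integrable_abs Bochner_Integration.integrable_diff)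
    have "(\<integral>x. \<bar>f x - g x\<bar> \<partial>unit_leb) \<le> (\<integral>x. \<bar>f x - h x\<bar> + \<bar>g x - h x\<bar> \<partial>unit_leb)"
      by (rule integral_mono) (use int in \<open>auto intro!: I Bochner_Integration.integrable_add\<close>)
    also have "\<dots> = (\<integral>x. \<bar>f x - h x\<bar> \<partial>unit_leb) + (\<integral>x. \<bar>g x - h x\<bar> \<partial>unit_leb)"
      by (rule Bochner_Integration.integral_add) (use int I in auto)
    finally show "(\<integral>x. \<bar>f x - g x\<bar> \<partial>unit_leb)
        \<le> (\<integral>x. \<bar>f x - h x\<bar> \<partial>unit_leb) + (\<integral>x. \<bar>g x - h x\<bar> \<partial>unit_leb)" .
  qed
qed

end

definition lip_const :: "'a set \<Rightarrow> ('a \<Rightarrow> 'a \<Rightarrow> real) \<Rightarrow> ('b \<Rightarrow> 'b \<Rightarrow> real) \<Rightarrow> ('a \<Rightarrow> 'b) \<Rightarrow> ennreal" where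
  "lip_const X dX dY f =
     (SUP (x, y) \<in> {(x, y). x \<in> X \<and> y \<in> X \<and> x \<noteq> y}. ennreal (dY (f x) (f y) / dX x y))"

definition distortion :: "'a set \<Rightarrow> ('a \<Rightarrow> 'a \<Rightarrow> real) \<Rightarrow> ('b \<Rightarrow> 'b \<Rightarrow> real) \<Rightarrow> ('a \<Rightarrow> 'b) \<Rightarrow> ennreal" where
  "distortion X dX dY f =
     (if inj_on f X then lip_const X dX dY f * lip_const (f ` X) dY dX (inv_into X f) else \<infinity>)"

definition c1 :: "'a set \<Rightarrow> ('a \<Rightarrow> 'a \<Rightarrow> real) \<Rightarrow> ennreal" where
  "c1 X d = (INF f. distortion X d dist (f :: 'a \<Rightarrow> L1))"

text \<open>Edges have identities of their own type; \<open>tail\<close> and \<open>head\<close> record the fixed reference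
  orientation, which matters for composition but not for walks.\<close>

record ('v, 'e) st_graph =
  verts :: "'v set"
  edges :: "'e set"
  tail :: "'e \<Rightarrow> 'v"
  head :: "'e \<Rightarrow> 'v"
  len :: "'e \<Rightarrow> real"
  src :: 'v
  snk :: 'v

inductive walk :: "('v, 'e) st_graph \<Rightarrow> 'v \<Rightarrow> real \<Rightarrow> 'v \<Rightarrow> bool" for G where
  nil: "u \<in> verts G \<Longrightarrow> walk G u 0 u"
| fwd: "e \<in> edges G \<Longrightarrow> walk G (head G e) l w \<Longrightarrow> walk G (tail G e) (len G e + l) w"
| bwd: "e \<in> edges G \<Longrightarrow> walk G (tail G e) l w \<Longrightarrow> walk G (head G e) (len G e + l) w"

text \<open>Meaningful for connected graphs with nonnegative lengths, where the set of lengths of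
  walks is nonempty and bounded below.\<close>

definition sp_dist :: "('v, 'e) st_graph \<Rightarrow> 'v \<Rightarrow> 'v \<Rightarrow> real" where
  "sp_dist G u v = Inf {l. walk G u l v}"

text \<open>All powers of \<open>G\<close> share one vertex type: \<open>Old v\<close> is a vertex \<open>v\<close> of the left factor, and
  \<open>New e x\<close> is the non-terminal vertex \<open>x\<close> of the copy of \<open>G\<close> that replaces the edge \<open>e\<close>.
  The edge coming from \<open>a\<close> in the copy of \<open>G\<close> that replaces \<open>e\<close> is \<open>a # e\<close>.\<close>

datatype ('v, 'e) pvert = Src | Snk | Old "('v, 'e) pvert" | New "'e list" 'v

definition glue ::
  "(('v, 'e) pvert, 'e list) st_graph \<Rightarrow> ('v, 'e) st_graph \<Rightarrow> 'e list \<Rightarrow> 'v \<Rightarrow> ('v, 'e) pvert" where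
  "glue H G e x =
     (if x = src G then Old (tail H e) else if x = snk G then Old (head H e) else New e x)"

definition oslash ::
  "(('v, 'e) pvert, 'e list) st_graph \<Rightarrow> ('v, 'e) st_graph \<Rightarrow> (('v, 'e) pvert, 'e list) st_graph"
  (infixl "\<oslash>" 70) where
  "H \<oslash> G = \<lparr>
     verts = Old ` verts H \<union> {glue H G e x | e x. e \<in> edges H \<and> x \<in> verts G},
     edges = {a # e | a e. a \<in> edges G \<and> e \<in> edges H},
     tail = (\<lambda>b. glue H G (tl b) (tail G (hd b))),
     head = (\<lambda>b. glue H G (tl b) (head G (hd b))),
     len = (\<lambda>b. len G (hd b) * (len H (tl b) / sp_dist G (src G) (snk G))),
     src = Old (src H),
     snk = Old (snk H)\<rparr>"

definition single_edge :: "(('v, 'e) pvert, 'e list) st_graph" where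
  "single_edge = \<lparr>verts = {Src, Snk}, edges = {[]}, tail = (\<lambda>_. Src), head = (\<lambda>_. Snk),
     len = (\<lambda>_. 1), src = Src, snk = Snk\<rparr>"

fun oslash_pow :: "('v, 'e) st_graph \<Rightarrow> nat \<Rightarrow> (('v, 'e) pvert, 'e list) st_graph" where
  "oslash_pow G 0 = single_edge"
| "oslash_pow G (Suc k) = oslash_pow G k \<oslash> G"

definition K2 :: "nat \<Rightarrow> (bool + nat, bool \<times> nat) st_graph" where
  "K2 n = \<lparr>verts = range Inl \<union> Inr ` {..<n}, edges = UNIV \<times> {..<n},
     tail = (\<lambda>(b, i). Inl b), head = (\<lambda>(b, i). Inr i), len = (\<lambda>_. 1),
     src = Inl False, snk = Inl True\<rparr>"

lemma walk_K2_bound: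
  assumes "walk (K2 n) u l v"
  shows "l \<ge> 0 \<and> (u \<noteq> v \<longrightarrow> l \<ge> 1) \<and> (isl u \<and> isl v \<and> u \<noteq> v \<longrightarrow> l \<ge> 2)"
  using assms by induction (auto simp: K2_def)

lemma sp_dist_K2:
  assumes "n \<ge> 1"
  shows "sp_dist (K2 n) (src (K2 n)) (snk (K2 n)) = 2"
proof -
  let ?G = "K2 n"
  have "walk ?G (Inl True) 0 (Inl True)"
    by (rule walk.nil) (simp add: K2_def)
  with walk.bwd[of "(True, 0)" ?G 0 "Inl True"] assms have "walk ?G (Inr 0) 1 (Inl True)"
    by (simp add: K2_def)
  with walk.fwd[of "(False, 0)" ?G 1 "Inl True"] assms have "walk ?G (Inl False) 2 (Inl True)"
    by (simp add: K2_def)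
  then have "Inf {l. walk ?G (Inl False) l (Inl True)} = 2"
    by (intro cInf_eq_minimum) (auto dest: walk_K2_bound)
  then show ?thesis
    by (simp add: sp_dist_def K2_def)
qed

lemma len_K2_pow:
  assumes "n \<ge> 1" "e \<in> edges (oslash_pow (K2 n) k)"
  shows "len (oslash_pow (K2 n) k) e = 1 / 2 ^ k"
  using assms(2)
proof (induction k arbitrary: e)
  case 0
  then show ?case by (simp add: single_edge_def)
next
  case (Suc k)
  then obtain a e' where "e = a # e'" "e' \<in> edges (oslash_pow (K2 n) k)"
    by (auto simp: oslash_def)
  moreover have "len (K2 n) a = 1" by (simp add: K2_def)
  ultimately show ?case
    using Suc.IH assms(1) by (simp add: oslash_def sp_dist_K2)
qed

end

theory Submission
  imports Defs "HOL-Probability.Product_PMF"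
begin

text \<open>Let \<open>m = \<lceil>n / 2\<rceil>\<close>. Cut the graph at random from the top down: starting with \<open>s\<close> and \<open>t\<close> on
  different sides, whenever an edge is refined, a uniformly random \<open>m\<close>-element subset of \<open>2m\<close>
  midpoints joins one endpoint and the rest join the other, independently for all edges. An edge at
  level \<open>k\<close> is then separated with probability exactly \<open>2\<^sup>-\<^sup>k\<close>, so the separation probability is an
  \<open>L\<^sub>1\<close> pseudometric bounded by the graph metric. Conversely, two points lying in copies attached to
  opposite terminals at distances \<open>x, y \<le> 1/2\<close> on different \<open>s\<close>-\<open>t\<close> paths have distance
  \<open>1 - \<bar>x - y\<bar>\<close> and are separated with probability \<open>1 - x - y + 4m/(2m - 1) x y\<close>; the ratio is
  smallest at \<open>x = y = (2m - 1)/(4m)\<close>, where it equals \<open>(2m + 1)/(4m)\<close>. All other pairs are better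
  or reduce to a smaller power by self-similarity.\<close>

section \<open>Walks\<close>

lemma walk_trans:
  assumes "walk G u l v" "walk G v l' w" shows "walk G u (l + l') w"
  using assms by induction (auto simp: add.assoc intro: walk.intros)

lemma walk_sym:
  assumes "walk G u l v" and "\<And>e. e \<in> edges G \<Longrightarrow> tail G e \<in> verts G \<and> head G e \<in> verts G"
  shows "walk G v l u"
  using assms(1)
proof induction
  case (nil u)
  then show ?case by (rule walk.nil)
next
  case (fwd e l w)
  have "walk G (head G e) (len G e + 0) (tail G e)"
    using fwd assms(2) by (intro walk.bwd walk.nil) auto
  from walk_trans[OF fwd.IH this] show ?case by (simp add: add.commute)
next
  case (bwd e l w)
  have "walk G (tail G e) (len G e + 0) (head G e)"
    using bwd assms(2) by (intro walk.fwd walk.nil) auto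
  from walk_trans[OF bwd.IH this] show ?case by (simp add: add.commute)
qed

text \<open>A walk between distinct vertices uses at least one edge. With \<open>c\<close> the
  common edge length, this later makes \<open>sp_dist\<close> positive.\<close>

lemma walk_len_ge:
  assumes "walk G u l v" and "\<And>e. e \<in> edges G \<Longrightarrow> len G e \<ge> c" and "c \<ge> 0"
  shows "l \<ge> 0 \<and> (u \<noteq> v \<longrightarrow> l \<ge> c)"
  using assms(1)
proof induction
  case (fwd e l w)
  then show ?case using assms(2)[of e] assms(3) by auto
next
  case (bwd e l w)
  then show ?case using assms(2)[of e] assms(3) by auto
qed simp

text \<open>Add up the edge bounds along the walk. With \<open>\<rho>\<close> a separation
  probability, this is the Lipschitz half of the distortion bound.\<close>

lemma walk_len_ge_pseudometric:
  fixes \<rho> :: "'v \<Rightarrow> 'v \<Rightarrow> real"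
  assumes "walk G u l v"
    and "\<And>e. e \<in> edges G \<Longrightarrow> \<rho> (tail G e) (head G e) \<le> len G e"
    and refl: "\<And>x. \<rho> x x = 0" and sym: "\<And>x y. \<rho> x y = \<rho> y x"
    and tri: "\<And>x y z. \<rho> x z \<le> \<rho> x y + \<rho> y z"
  shows "\<rho> u v \<le> l"
  using assms(1)
proof induction
  case (nil u)
  then show ?case by (simp add: refl)
next
  case (fwd e l w)
  with assms(2)[of e] tri[of "tail G e" w "head G e"] show ?case by simp
next
  case (bwd e l w)
  with assms(2)[of e] tri[of "head G e" w "tail G e"] sym[of "head G e" "tail G e"]
  show ?case by simp
qed

section \<open>Self-similarity of the powers of \<open>K\<^bsub>2,n\<^esub>\<close>\<close>

abbreviation Kpow :: "nat \<Rightarrow> nat \<Rightarrow> ((bool + nat, bool \<times> nat) pvert, (bool \<times> nat) list) st_graph" where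
  "Kpow n k \<equiv> oslash_pow (K2 n) k"

text \<open>\<open>Kpow n (Suc k)\<close> is by definition \<open>Kpow n k\<close> with every edge refined, but it is also
  \<open>K2 n\<close> with every edge \<open>a\<close> replaced by a half-scale copy of \<open>Kpow n k\<close>. The map
  \<open>copy_vert a\<close> is the inclusion of that copy; it sends the edge \<open>e\<close> to \<open>e @ [a]\<close>.\<close>

fun copy_vert :: "bool \<times> nat \<Rightarrow> (bool + nat, bool \<times> nat) pvert \<Rightarrow> (bool + nat, bool \<times> nat) pvert" where
  "copy_vert (b, i) Src = Old (if b then Snk else Src)"
| "copy_vert (b, i) Snk = New [] (Inr i)"
| "copy_vert a (Old v) = Old (copy_vert a v)"
| "copy_vert a (New e x) = New (e @ [a]) x"

declare oslash_pow.simps [simp del]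

lemma edges_Kpow_0 [simp]: "edges (Kpow n 0) = {[]}"
  by (simp add: oslash_pow.simps single_edge_def)

lemma edges_Kpow_Suc: "edges (Kpow n (Suc k)) = {a # e | a e. a \<in> UNIV \<times> {..<n} \<and> e \<in> edges (Kpow n k)}"
  by (simp add: oslash_pow.simps oslash_def K2_def)

text \<open>The recursion peels off the first letter, the finest level; a description by words
  allows peeling off the last letter, the coarsest level, instead.\<close>

lemma edges_Kpow: "edges (Kpow n k) = {e. length e = k \<and> set e \<subseteq> UNIV \<times> {..<n}}"
proof (induction k)
  case (Suc k)
  show ?case unfolding edges_Kpow_Suc Suc
    by (auto simp: length_Suc_conv)
qed (auto simp: edges_Kpow_0)

lemma edges_Kpow_SucE:
  assumes "e \<in> edges (Kpow n (Suc k))"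
  obtains e' a where "e = e' @ [a]" "e' \<in> edges (Kpow n k)" "a \<in> UNIV \<times> {..<n}"
  using assms by (cases e rule: rev_cases) (auto simp: edges_Kpow)

lemma append_in_edges_Kpow:
  assumes "e \<in> edges (Kpow n k)" "a \<in> UNIV \<times> {..<n}"
  shows "e @ [a] \<in> edges (Kpow n (Suc k))"
  using assms by (auto simp: edges_Kpow)

lemma tail_head_Kpow_Suc:
  "tail (Kpow n (Suc k)) ((b, i) # e) = Old ((if b then head else tail) (Kpow n k) e)"
  "head (Kpow n (Suc k)) ((b, i) # e) = New e (Inr i)"
  by (auto simp: oslash_pow.simps oslash_def K2_def glue_def)

lemma src_snk_Kpow_0: "src (Kpow n 0) = Src" "snk (Kpow n 0) = Snk"
  by (simp_all add: oslash_pow.simps single_edge_def)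

lemma src_snk_Kpow_Suc: "src (Kpow n (Suc k)) = Old (src (Kpow n k))" "snk (Kpow n (Suc k)) = Old (snk (Kpow n k))"
  by (simp_all add: oslash_pow.simps oslash_def)

lemma verts_Kpow_0: "verts (Kpow n 0) = {Src, Snk}"
  by (simp add: oslash_pow.simps single_edge_def)

text \<open>Refinement adds a letter in front and inclusion in a copy adds one at the back, so the
  two operations commute.\<close>

lemma tail_head_Kpow_append:
  assumes "e \<in> edges (Kpow n k)"
  shows "tail (Kpow n (Suc k)) (e @ [a]) = copy_vert a (tail (Kpow n k) e)
    \<and> head (Kpow n (Suc k)) (e @ [a]) = copy_vert a (head (Kpow n k) e)"
  using assms
proof (induction k arbitrary: e)
  case 0
  then have "e = []" by (simp add: edges_Kpow_0)
  then show ?case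
    by (cases a) (auto simp: tail_head_Kpow_Suc oslash_pow.simps(1) single_edge_def)
next
  case (Suc k)
  then obtain b i e' where e: "e = (b, i) # e'" "e' \<in> edges (Kpow n k)"
    by (auto simp: edges_Kpow_Suc)
  show ?case using Suc.IH[OF e(2)]
    by (auto simp: e tail_head_Kpow_Suc)
qed

lemma tail_head_in_verts_Kpow:
  assumes "e \<in> edges (Kpow n k)"
  shows "tail (Kpow n k) e \<in> verts (Kpow n k) \<and> head (Kpow n k) e \<in> verts (Kpow n k)"
proof (cases k)
  case 0
  then show ?thesis by (simp add: oslash_pow.simps single_edge_def)
next
  case (Suc k')
  obtain a e' where e: "e = a # e'" "a \<in> edges (K2 n)" "e' \<in> edges (Kpow n k')"
    using assms by (auto simp: Suc oslash_pow.simps oslash_def)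
  moreover have "tail (K2 n) a \<in> verts (K2 n)" "head (K2 n) a \<in> verts (K2 n)"
    using e(2) by (auto simp: K2_def)
  ultimately show ?thesis by (auto simp: Suc oslash_pow.simps oslash_def)
qed

lemma verts_Kpow_Suc:
  "verts (Kpow n (Suc k)) = Old ` verts (Kpow n k) \<union> {New e (Inr i) | e i. e \<in> edges (Kpow n k) \<and> i < n}"
  (is "_ = ?R")
proof -
  have verts: "verts (Kpow n (Suc k)) =
      Old ` verts (Kpow n k) \<union> {glue (Kpow n k) (K2 n) e x | e x. e \<in> edges (Kpow n k) \<and> x \<in> verts (K2 n)}"
    by (simp add: oslash_pow.simps oslash_def)
  have "glue (Kpow n k) (K2 n) e x \<in> ?R" if "e \<in> edges (Kpow n k)" "x \<in> verts (K2 n)" for e x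
    using that tail_head_in_verts_Kpow[OF that(1)] by (auto simp: glue_def K2_def)
  then have "verts (Kpow n (Suc k)) \<subseteq> ?R" unfolding verts by fast
  moreover have "New e (Inr i) \<in> verts (Kpow n (Suc k))" if "e \<in> edges (Kpow n k)" "i < n" for e i
  proof -
    have "New e (Inr i) = glue (Kpow n k) (K2 n) e (Inr i)" "Inr i \<in> verts (K2 n)"
      using that by (simp_all add: glue_def K2_def)
    with that(1) show ?thesis unfolding verts by fast
  qed
  moreover have "Old ` verts (Kpow n k) \<subseteq> verts (Kpow n (Suc k))" unfolding verts by fast
  ultimately show ?thesis by fast
qed

lemma verts_Kpow_SucE:
  assumes "n \<ge> 1" "v \<in> verts (Kpow n (Suc k))"
  obtains b i u where "v = copy_vert (b, i) u" "u \<in> verts (Kpow n k)" "i < n"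
proof -
  have "\<exists>b i u. v = copy_vert (b, i) u \<and> u \<in> verts (Kpow n k) \<and> i < n"
    using assms(2)
  proof (induction k arbitrary: v)
    case 0
    then consider "v = Old Src" | "v = Old Snk" | i where "i < n" "v = New [] (Inr i)"
      using assms(1) by (auto simp: verts_Kpow_Suc verts_Kpow_0)
    then show ?case
    proof cases
      \<comment> \<open>A terminal is the source of every copy attached to it;
        \<open>n \<ge> 1\<close> provides the copy with index 0.\<close>
      case 1
      then show ?thesis using assms(1)
        by (intro exI[of _ False] exI[of _ 0] exI[of _ Src]) (simp add: verts_Kpow_0)
    next
      case 2
      then show ?thesis using assms(1)
        by (intro exI[of _ True] exI[of _ 0] exI[of _ Src]) (simp add: verts_Kpow_0)
    next
      case 3
      then show ?thesis
        by (intro exI[of _ True] exI[of _ i] exI[of _ Snk]) (simp add: verts_Kpow_0)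
    qed
  next
    case (Suc k)
    then consider v' where "v = Old v'" "v' \<in> verts (Kpow n (Suc k))"
      | e j where "v = New e (Inr j)" "e \<in> edges (Kpow n (Suc k))" "j < n"
      using verts_Kpow_Suc[of n "Suc k"] by blast
    then show ?case
    proof cases
      case 1
      from Suc.IH[OF 1(2)] obtain b i u
        where u: "v' = copy_vert (b, i) u" "u \<in> verts (Kpow n k)" "i < n" by blast
      have "v = copy_vert (b, i) (Old u)" "Old u \<in> verts (Kpow n (Suc k))"
        using 1 u verts_Kpow_Suc[of n k] by auto
      then show ?thesis using u by blast
    next
      case 2
      then obtain e' a where e: "e = e' @ [a]" "e' \<in> edges (Kpow n k)" "a \<in> UNIV \<times> {..<n}"
        by (elim edges_Kpow_SucE)
      have "v = copy_vert a (New e' (Inr j))" "New e' (Inr j) \<in> verts (Kpow n (Suc k))"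
        using 2 e verts_Kpow_Suc[of n k] by auto
      then show ?thesis using e(3) by (cases a) blast
    qed
  qed
  then show ?thesis using that by blast
qed

lemma copy_vert_src: "copy_vert (b, i) (src (Kpow n k)) = (if b then snk else src) (Kpow n (Suc k))"
proof (induction k)
  case 0
  then show ?case by (simp add: src_snk_Kpow_0 src_snk_Kpow_Suc)
next
  case (Suc k)
  then show ?case by (simp add: src_snk_Kpow_Suc)
qed

text \<open>Both copies with index \<open>i\<close> are oriented towards midpoint \<open>i\<close>,
  so their sinks are glued together there.\<close>

lemma copy_vert_snk: "copy_vert (b, i) (snk (Kpow n k)) = copy_vert (b', i) (snk (Kpow n k))"
proof (induction k)
  case 0
  then show ?case by (simp add: src_snk_Kpow_0)
next
  case (Suc k)
  then show ?case by (simp add: src_snk_Kpow_Suc)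
qed

lemma copy_vert_in_verts:
  assumes "n \<ge> 1" "i < n" "v \<in> verts (Kpow n k)"
  shows "copy_vert (b, i) v \<in> verts (Kpow n (Suc k))"
  using assms(3)
proof (induction k arbitrary: v)
  case 0
  then show ?case using assms
    by (cases b) (auto simp: verts_Kpow_0 verts_Kpow_Suc)
next
  case (Suc k)
  have "e @ [(b, i)] \<in> edges (Kpow n (Suc k))" if "e \<in> edges (Kpow n k)" for e
    using that assms(2) by (intro append_in_edges_Kpow) auto
  with Suc show ?case using assms(1)
    by (auto simp: verts_Kpow_Suc)
qed

lemma walk_copy_vert:
  assumes "n \<ge> 1" "i < n" "walk (Kpow n k) u l v"
  shows "walk (Kpow n (Suc k)) (copy_vert (b, i) u) (l / 2) (copy_vert (b, i) v)"
  using assms(3)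
proof induction
  case (nil u)
  then show ?case using copy_vert_in_verts[OF assms(1,2)] by (simp add: walk.nil)
next
  case (fwd e l w)
  have e: "e @ [(b, i)] \<in> edges (Kpow n (Suc k))"
    using fwd assms by (intro append_in_edges_Kpow) auto
  from walk.fwd[OF e] fwd.IH tail_head_Kpow_append[OF fwd(1), of "(b, i)"]
  show ?case using len_K2_pow[OF assms(1) e] len_K2_pow[OF assms(1) fwd(1)]
    by (simp add: add_divide_distrib mult.commute)
next
  case (bwd e l w)
  have e: "e @ [(b, i)] \<in> edges (Kpow n (Suc k))"
    using bwd assms by (intro append_in_edges_Kpow) auto
  from walk.bwd[OF e] bwd.IH tail_head_Kpow_append[OF bwd(1), of "(b, i)"]
  show ?case using len_K2_pow[OF assms(1) e] len_K2_pow[OF assms(1) bwd(1)]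
    by (simp add: add_divide_distrib mult.commute)
qed

lemma walk_sym_Kpow: "walk (Kpow n k) u l v \<Longrightarrow> walk (Kpow n k) v l u"
  by (rule walk_sym) (use tail_head_in_verts_Kpow in blast)+

section \<open>Random cuts\<close>

text \<open>A family \<open>\<omega>\<close> of sets of midpoints, one for every edge at every level, determines a cut.
  The value \<open>False\<close> is the side of the source. \<open>cut_ends \<omega> e\<close> is the pair of sides of the tail and
  the head of \<open>e\<close>; when \<open>e\<close> is refined, the new midpoint \<open>i\<close> joins the head if \<open>i \<in> \<omega> e\<close>, and the
  tail otherwise.\<close>

fun cut_ends :: "((bool \<times> nat) list \<Rightarrow> nat set) \<Rightarrow> (bool \<times> nat) list \<Rightarrow> bool \<times> bool" where
  "cut_ends \<omega> [] = (False, True)"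
| "cut_ends \<omega> ((b, i) # e) =
     (let (s, t) = cut_ends \<omega> e in (if b then t else s, if i \<in> \<omega> e then t else s))"

fun cut :: "((bool \<times> nat) list \<Rightarrow> nat set) \<Rightarrow> (bool + nat, bool \<times> nat) pvert \<Rightarrow> bool" where
  "cut \<omega> Src = False"
| "cut \<omega> Snk = True"
| "cut \<omega> (Old v) = cut \<omega> v"
| "cut \<omega> (New e x) =
     (if (case x of Inl b \<Rightarrow> b | Inr i \<Rightarrow> i \<in> \<omega> e) then snd (cut_ends \<omega> e) else fst (cut_ends \<omega> e))"

text \<open>The last letter of an edge tells which top-level copy contains it: \<open>A\<close> is
  the choice at the root edge, and \<open>c a\<close> is the family used inside copy
  \<open>a\<close>.\<close>

definition join :: "nat set \<Rightarrow> (bool \<times> nat \<Rightarrow> (bool \<times> nat) list \<Rightarrow> nat set) \<Rightarrow> (bool \<times> nat) list \<Rightarrow> nat set" where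
  "join A c e = (if e = [] then A else c (last e) (butlast e))"

lemma join_simps [simp]: "join A c [] = A" "join A c (e @ [a]) = c a e"
  by (simp_all add: join_def)

text \<open>Inside copy \<open>(b, i)\<close> the local source side becomes the side
  \<open>b\<close> of its terminal, and the local sink side becomes the side of midpoint
  \<open>i\<close>, which is \<open>i \<in> A\<close>.\<close>

lemma cut_ends_join:
  "cut_ends (join A c) (e @ [(b, i)]) =
     map_prod (\<lambda>y. if y then i \<in> A else b) (\<lambda>y. if y then i \<in> A else b) (cut_ends (c (b, i)) e)"
proof (induction e)
  case Nil
  show ?case using join_simps(1)[of A c] by (simp del: join_simps)
next
  case (Cons a e)
  then show ?case
    by (cases a) (auto split: prod.splits)
qed

lemma cut_join_copy_vert:
  "cut (join A c) (copy_vert (b, i) v) = (if cut (c (b, i)) v then i \<in> A else b)"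
proof (induction v)
  case (New e x)
  show ?case by (cases x) (simp_all add: cut_ends_join)
qed auto

text \<open>For odd \<open>n\<close> and \<open>m = (n + 1) div 2\<close> the ground set has one
  index beyond the midpoints, so that exact halving stays possible.\<close>

definition halves :: "nat \<Rightarrow> nat set set" where
  "halves m = {A. A \<subseteq> {..<2 * m} \<and> card A = m}"

text \<open>Recursion from the coarsest level: the root edge draws its half, and the copies draw
  their own cuts independently.\<close>

fun cut_pmf :: "nat \<Rightarrow> nat \<Rightarrow> ((bool \<times> nat) list \<Rightarrow> nat set) pmf" where
  "cut_pmf n 0 = return_pmf (\<lambda>_. {})"
| "cut_pmf n (Suc k) = map_pmf (\<lambda>(A, c). join A c)
     (pair_pmf (pmf_of_set (halves ((n + 1) div 2)))
       (Pi_pmf ((UNIV :: bool set) \<times> {..<n}) (\<lambda>_. {}) (\<lambda>_. cut_pmf n k)))"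

section \<open>Counting balanced subsets\<close>

lemma finite_halves [simp]: "finite (halves m)"
  by (rule finite_subset[of _ "Pow {..<2 * m}"]) (auto simp: halves_def)

lemma card_halves: "card (halves m) = (2 * m) choose m"
  using n_subsets[of "{..<2 * m}" m] by (simp add: halves_def)

lemma halves_nonempty [simp]: "halves m \<noteq> {}"
proof -
  have "{..<m} \<in> halves m" by (auto simp: halves_def)
  then show ?thesis by blast
qed

lemma finite_set_cut_pmf: "finite (set_pmf (cut_pmf n k))"
proof (induction k)
  case (Suc k)
  have "set_pmf (Pi_pmf ((UNIV :: bool set) \<times> {..<n}) (\<lambda>_. {}) (\<lambda>_. cut_pmf n k))
      = PiE_dflt ((UNIV :: bool set) \<times> {..<n}) (\<lambda>_. {}) (set_pmf \<circ> (\<lambda>_. cut_pmf n k))"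
    by (rule set_Pi_pmf) (intro finite_cartesian_product, auto)
  moreover have "finite \<dots>"
    using Suc by (intro finite_PiE_dflt finite_cartesian_product) auto
  ultimately show ?case by simp
qed simp

text \<open>Removing \<open>X\<close> is a bijection onto the \<open>r\<close>-element subsets of
  \<open>U - X\<close>.\<close>

lemma card_supersets:
  assumes "finite U" "X \<subseteq> U"
  shows "card {A. X \<subseteq> A \<and> A \<subseteq> U \<and> card A = card X + r} = (card U - card X) choose r"
proof -
  have fin: "finite X" using assms finite_subset by blast
  have "bij_betw (\<lambda>B. X \<union> B) {B. B \<subseteq> U - X \<and> card B = r} {A. X \<subseteq> A \<and> A \<subseteq> U \<and> card A = card X + r}"
  proof (rule bij_betw_byWitness[where f' = "\<lambda>A. A - X"])
    have "card (X \<union> B) = card X + card B" if "B \<subseteq> U - X" for B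
      using that fin finite_subset[OF that] assms(1) by (intro card_Un_disjoint) auto
    then show "(\<lambda>B. X \<union> B) ` {B. B \<subseteq> U - X \<and> card B = r} \<subseteq> {A. X \<subseteq> A \<and> A \<subseteq> U \<and> card A = card X + r}"
      using assms(2) by blast
    have "card (A - X) = r" if "X \<subseteq> A" "card A = card X + r" for A
      using card_Diff_subset[OF fin that(1)] that(2) by simp
    then show "(\<lambda>A. A - X) ` {A. X \<subseteq> A \<and> A \<subseteq> U \<and> card A = card X + r} \<subseteq> {B. B \<subseteq> U - X \<and> card B = r}"
      by blast
  qed blast+
  then have "card {A. X \<subseteq> A \<and> A \<subseteq> U \<and> card A = card X + r} = card {B. B \<subseteq> U - X \<and> card B = r}"
    by (rule bij_betw_same_card[symmetric])
  also have "\<dots> = card (U - X) choose r"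
    using assms by (intro n_subsets) auto
  also have "card (U - X) = card U - card X"
    using fin assms(2) by (rule card_Diff_subset)
  finally show ?thesis .
qed

lemma odd_binomial_symmetric: "Suc (2 * p) choose Suc p = Suc (2 * p) choose p"
proof -
  have "Suc (2 * p) - p = Suc p" by simp
  moreover have "Suc (2 * p) choose p = Suc (2 * p) choose (Suc (2 * p) - p)"
    by (rule binomial_symmetric) simp
  ultimately show ?thesis by (simp only:)
qed

lemma central_binomial_Suc: "(2 * Suc p) choose (Suc p) = 2 * (Suc (2 * p) choose p)"
proof -
  have "2 * Suc p = Suc (Suc (2 * p))" by simp
  then show ?thesis
    by (simp only: binomial_Suc_Suc[of "Suc (2 * p)" p] odd_binomial_symmetric)
qed

text \<open>This is the quotient of \<open>(2 * m - 2) choose (m - 1)\<close> by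
  \<open>(2 * m) choose m\<close>. It exceeds 1/4: membership of two indices is negatively
  correlated, which is the gain over independent fair coins.\<close>

lemma prob_halves_mem_notmem:
  assumes "i < 2 * m" "j < 2 * m" "i \<noteq> j"
  shows "measure_pmf.prob (pmf_of_set (halves m)) {A. i \<in> A \<and> j \<notin> A} = real m / (2 * (2 * real m - 1))"
proof -
  obtain p where m: "m = Suc p" using assms by (cases m) auto
  have "halves m \<inter> {A. i \<in> A \<and> j \<notin> A} = {A. {i} \<subseteq> A \<and> A \<subseteq> {..<2 * m} - {j} \<and> card A = card {i} + p}"
    by (auto simp: halves_def m)
  also have "card \<dots> = (card ({..<2 * m} - {j}) - card {i}) choose p"
    using assms by (intro card_supersets) auto
  also have "card ({..<2 * m} - {j}) - card {i} = 2 * p"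
    using assms by (simp add: m)
  finally have 1: "card (halves m \<inter> {A. i \<in> A \<and> j \<notin> A}) = (2 * p) choose p" .
  \<comment> \<open>The absorption identity relates the count \<open>(2 * p) choose p\<close> to
    half of the central binomial coefficient.\<close>
  have "Suc p * (Suc (2 * p) choose p) = Suc (2 * p) * ((2 * p) choose p)"
    using Suc_times_binomial[of p "2 * p"] by (simp only: odd_binomial_symmetric)
  then have "real (Suc p) * real (Suc (2 * p) choose p) = real (Suc (2 * p)) * real ((2 * p) choose p)"
    by (simp only: of_nat_mult[symmetric])
  moreover have "real (card (halves m)) = 2 * real (Suc (2 * p) choose p)"
    unfolding card_halves m central_binomial_Suc by (simp only: of_nat_mult of_nat_numeral)
  moreover have "real (Suc (2 * p)) = 2 * real m - 1" by (simp add: m)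
  ultimately have "real ((2 * p) choose p) * (2 * (2 * real m - 1)) = real m * real (card (halves m))"
    unfolding m by (simp only: mult_ac)
  moreover have "real (card (halves m)) \<noteq> 0" "2 * (2 * real m - 1) \<noteq> 0" by (simp, simp add: m)
  ultimately have "real ((2 * p) choose p) / real (card (halves m)) = real m / (2 * (2 * real m - 1))"
    by (subst frac_eq_eq)
  then show ?thesis by (simp only: measure_pmf_of_set[OF halves_nonempty finite_halves] 1)
qed

lemma prob_halves_mem:
  assumes "i < 2 * m"
  shows "measure_pmf.prob (pmf_of_set (halves m)) {A. i \<in> A} = 1 / 2"
proof -
  obtain p where m: "m = Suc p" using assms by (cases m) auto
  have "halves m \<inter> {A. i \<in> A} = {A. {i} \<subseteq> A \<and> A \<subseteq> {..<2 * m} \<and> card A = card {i} + p}"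
    by (auto simp: halves_def m)
  also have "card \<dots> = (card {..<2 * m} - card {i}) choose p"
    using assms by (intro card_supersets) auto
  also have "card {..<2 * m} - card {i} = Suc (2 * p)"
    by (simp add: m)
  finally have 1: "card (halves m \<inter> {A. i \<in> A}) = Suc (2 * p) choose p" .
  have "card (halves m) = 2 * (Suc (2 * p) choose p)"
    unfolding card_halves m by (rule central_binomial_Suc)
  moreover have "card (halves m) > 0" by (simp add: card_gt_0_iff)
  ultimately show ?thesis
    by (simp only: measure_pmf_of_set[OF halves_nonempty finite_halves] 1) (simp del: binomial_Suc_Suc)
qed

section \<open>Probabilities under product distributions\<close>

lemma prob_pair_pmf_Times:
  "measure_pmf.prob (pair_pmf M N) (A \<times> B) = measure_pmf.prob M A * measure_pmf.prob N B"
proof -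
  \<comment> \<open>Pass to the supports, which are countable as the product rule requires.\<close>
  have "measure_pmf.prob (pair_pmf M N) (A \<times> B)
      = measure_pmf.prob (pair_pmf M N) ((A \<times> B) \<inter> set_pmf (pair_pmf M N))"
    by (simp only: measure_Int_set_pmf)
  also have "(A \<times> B) \<inter> set_pmf (pair_pmf M N) = (A \<inter> set_pmf M) \<times> (B \<inter> set_pmf N)"
    by auto
  also have "measure_pmf.prob (pair_pmf M N) \<dots> = measure_pmf.prob M A * measure_pmf.prob N B"
    by (subst measure_pmf_prob_product) (auto simp: measure_Int_set_pmf)
  finally show ?thesis .
qed

lemma prob_Pi_pmf_two:
  assumes "finite E" "a \<in> E" "a' \<in> E" "a \<noteq> a'"
  shows "measure_pmf.prob (Pi_pmf E d (\<lambda>_. N)) {c. c a \<in> S \<and> c a' \<in> T}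
    = measure_pmf.prob N S * measure_pmf.prob N T"
proof -
  let ?B = "\<lambda>x. if x = a then S else if x = a' then T else UNIV"
  have "{c. c a \<in> S \<and> c a' \<in> T} = Pi E ?B"
    using assms by (auto simp: Pi_def split: if_splits)
  then have "measure_pmf.prob (Pi_pmf E d (\<lambda>_. N)) {c. c a \<in> S \<and> c a' \<in> T}
      = (\<Prod>x\<in>E. measure_pmf.prob N (?B x))"
    using assms(1) by (simp add: measure_Pi_pmf_Pi)
  also have "\<dots> = (\<Prod>x\<in>insert a (insert a' (E - {a, a'})). measure_pmf.prob N (?B x))"
    using assms by (intro prod.cong) auto
  also have "\<dots> = measure_pmf.prob N S * measure_pmf.prob N T *
      (\<Prod>x\<in>E - {a, a'}. measure_pmf.prob N (?B x))"
    using assms by (simp add: mult.assoc)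
  also have "(\<Prod>x\<in>E - {a, a'}. measure_pmf.prob N (?B x)) = 1"
    by (intro prod.neutral) auto
  finally show ?thesis by simp
qed

lemma prob_Pi_pmf_one:
  assumes "finite E" "a \<in> E"
  shows "measure_pmf.prob (Pi_pmf E d (\<lambda>_. N)) {c. c a \<in> S} = measure_pmf.prob N S"
proof -
  have "measure_pmf.prob N S = measure_pmf.prob (map_pmf (\<lambda>c. c a) (Pi_pmf E d (\<lambda>_. N))) S"
    using assms by (simp add: Pi_pmf_component)
  then show ?thesis by (simp add: vimage_def)
qed

lemma prob_xor:
  "measure_pmf.prob M {\<omega>. P \<omega> \<noteq> Q \<omega>} =
     measure_pmf.prob M {\<omega>. P \<omega>} + measure_pmf.prob M {\<omega>. Q \<omega>} - 2 * measure_pmf.prob M {\<omega>. P \<omega> \<and> Q \<omega>}"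
proof -
  have "measure_pmf.prob M ({\<omega>. P \<omega>} \<union> {\<omega>. Q \<omega>}) = measure_pmf.prob M {\<omega>. P \<omega>}
      + measure_pmf.prob M {\<omega>. Q \<omega>} - measure_pmf.prob M {\<omega>. P \<omega> \<and> Q \<omega>}"
    using measure_pmf.finite_measure_Union'[of "{\<omega>. P \<omega>}" M "{\<omega>. Q \<omega>}"]
      measure_pmf.finite_measure_Diff'[of "{\<omega>. Q \<omega>}" M "{\<omega>. P \<omega>}"]
    by (simp add: Int_def conj_commute)
  moreover have "measure_pmf.prob M ({\<omega>. P \<omega>} \<union> {\<omega>. Q \<omega>})
      = measure_pmf.prob M {\<omega>. P \<omega> \<noteq> Q \<omega>} + measure_pmf.prob M {\<omega>. P \<omega> \<and> Q \<omega>}"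
    by (subst measure_pmf.finite_measure_Union[symmetric]) (auto intro: arg_cong[where f = "measure_pmf.prob M"])
  ultimately show ?thesis by simp
qed

lemma prob_Not: "measure_pmf.prob M {\<omega>. \<not> P \<omega>} = 1 - measure_pmf.prob M {\<omega>. P \<omega>}"
  using measure_pmf.prob_compl[of "{\<omega>. P \<omega>}" M] by (simp add: Compl_eq_Diff_UNIV[symmetric] Collect_neg_eq)

section \<open>Height and separation under one refinement\<close>

definition height :: "nat \<Rightarrow> nat \<Rightarrow> (bool + nat, bool \<times> nat) pvert \<Rightarrow> real" where
  "height n k u = measure_pmf.prob (cut_pmf n k) {\<omega>. cut \<omega> u}"

definition sep :: "nat \<Rightarrow> nat \<Rightarrow> (bool + nat, bool \<times> nat) pvert \<Rightarrow> (bool + nat, bool \<times> nat) pvert \<Rightarrow> real" where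
  "sep n k u v = measure_pmf.prob (cut_pmf n k) {\<omega>. cut \<omega> u \<noteq> cut \<omega> v}"

lemma height_bounds: "0 \<le> height n k u" "height n k u \<le> 1"
  by (simp_all add: height_def)

lemma sep_triangle: "sep n k u w \<le> sep n k u v + sep n k v w"
proof -
  have "sep n k u w \<le> measure_pmf.prob (cut_pmf n k) ({\<omega>. cut \<omega> u \<noteq> cut \<omega> v} \<union> {\<omega>. cut \<omega> v \<noteq> cut \<omega> w})"
    unfolding sep_def by (intro measure_pmf.finite_measure_mono) auto
  also have "\<dots> \<le> sep n k u v + sep n k v w"
    unfolding sep_def by (intro measure_Un_le) auto
  finally show ?thesis .
qed

lemma sep_refl: "sep n k u u = 0"
  by (simp add: sep_def)

lemma sep_sym: "sep n k u v = sep n k v u"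
  by (simp add: sep_def eq_commute)

locale refined_cut =
  fixes n k :: nat
begin

definition "halves_pmf = pmf_of_set (halves ((n + 1) div 2))"

definition "copies_pmf = Pi_pmf ((UNIV :: bool set) \<times> {..<n}) (\<lambda>_. {}) (\<lambda>_. cut_pmf n k)"

lemma prob_cut_pmf_Suc:
  "measure_pmf.prob (cut_pmf n (Suc k)) {\<omega>. P \<omega>}
    = measure_pmf.prob (pair_pmf halves_pmf copies_pmf) {z. P (join (fst z) (snd z))}"
  by (simp add: halves_pmf_def copies_pmf_def vimage_def case_prod_unfold)

lemma prob_mem: "i < n \<Longrightarrow> measure_pmf.prob halves_pmf {A. b \<noteq> (i \<in> A)} = 1 / 2"
  using prob_halves_mem[of i "(n + 1) div 2"] prob_Not[of halves_pmf "\<lambda>A. i \<in> A"]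
  by (cases b) (auto simp: halves_pmf_def)

text \<open>The event that \<open>u\<close>, placed in copy \<open>(b, i)\<close>, ends up on the
  other side from the terminal of that copy: the copy is cut, and \<open>u\<close> is on the sink
  side of the cut inside it.\<close>

definition "active b i u z \<longleftrightarrow> cut (snd z (b, i)) u \<and> b \<noteq> (i \<in> fst z)"

lemma cut_join: "cut (join (fst z) (snd z)) (copy_vert (b, i) u) \<longleftrightarrow> b \<noteq> active b i u z"
  by (auto simp: cut_join_copy_vert active_def)

lemma finite_index: "finite ((UNIV :: bool set) \<times> {..<n})"
  by (intro finite_cartesian_product) auto

lemma prob_active:
  assumes "i < n"
  shows "measure_pmf.prob (pair_pmf halves_pmf copies_pmf) {z. active b i u z} = height n k u / 2"
proof -
  have "{z. active b i u z} = {A. b \<noteq> (i \<in> A)} \<times> {c. c (b, i) \<in> {\<omega>. cut \<omega> u}}"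
    by (auto simp: active_def)
  then show ?thesis
    using assms prob_mem[OF assms, of b] prob_Pi_pmf_one[OF finite_index, of "(b, i)" _ _ "{\<omega>. cut \<omega> u}"]
    by (simp only: prob_pair_pmf_Times copies_pmf_def height_def) simp
qed

text \<open>The cuts inside distinct copies are independent of each other and of the half
  \<open>A\<close>; only the two events about \<open>A\<close> are coupled, so their joint
  probability remains.\<close>

lemma prob_active_both:
  assumes "i < n" "j < n" "(b, i) \<noteq> (b', j)"
  shows "measure_pmf.prob (pair_pmf halves_pmf copies_pmf) {z. active b i u z \<and> active b' j v z}
    = measure_pmf.prob halves_pmf {A. b \<noteq> (i \<in> A) \<and> b' \<noteq> (j \<in> A)} * (height n k u * height n k v)"
proof -
  have "{z. active b i u z \<and> active b' j v z} = {A. b \<noteq> (i \<in> A) \<and> b' \<noteq> (j \<in> A)} \<times>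
      {c. c (b, i) \<in> {\<omega>. cut \<omega> u} \<and> c (b', j) \<in> {\<omega>. cut \<omega> v}}"
    by (auto simp: active_def)
  then show ?thesis
    using assms prob_Pi_pmf_two[OF finite_index, of "(b, i)" "(b', j)" _ _ "{\<omega>. cut \<omega> u}" "{\<omega>. cut \<omega> v}"]
    by (simp only: prob_pair_pmf_Times copies_pmf_def height_def) simp
qed

text \<open>For \<open>b \<noteq> b'\<close> this is \<open>prob_halves_mem_notmem\<close>; for
  \<open>b = b'\<close> subtract that value from the marginal 1/2.\<close>

lemma prob_mem_both:
  assumes "i < n" "j < n" "i \<noteq> j"
  defines "m \<equiv> (n + 1) div 2"
  shows "measure_pmf.prob halves_pmf {A. b \<noteq> (i \<in> A) \<and> b' \<noteq> (j \<in> A)} =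
    (if b = b' then 1 / 2 - real m / (2 * (2 * real m - 1)) else real m / (2 * (2 * real m - 1)))"
proof -
  have diff: "measure_pmf.prob halves_pmf {A. b \<noteq> (i \<in> A) \<and> b' \<noteq> (j \<in> A)} = real m / (2 * (2 * real m - 1))"
    if "b \<noteq> b'" for b b'
    using that assms prob_halves_mem_notmem[of i m j] prob_halves_mem_notmem[of j m i]
    by (cases b) (auto simp: halves_pmf_def m_def conj_commute)
  have "measure_pmf.prob halves_pmf {A. b \<noteq> (i \<in> A)}
      = measure_pmf.prob halves_pmf {A. b \<noteq> (i \<in> A) \<and> b \<noteq> (j \<in> A)}
      + measure_pmf.prob halves_pmf {A. b \<noteq> (i \<in> A) \<and> (\<not> b) \<noteq> (j \<in> A)}"
    by (subst measure_pmf.finite_measure_Union[symmetric]) (auto intro: arg_cong[where f = "measure_pmf.prob halves_pmf"])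
  then have "measure_pmf.prob halves_pmf {A. b \<noteq> (i \<in> A) \<and> b \<noteq> (j \<in> A)} = 1 / 2 - real m / (2 * (2 * real m - 1))"
    using diff[of b "\<not> b"] prob_mem[OF assms(1), of b] by linarith
  then show ?thesis
    using diff[of b b'] by (cases "b = b'") (simp_all only: if_True if_False refl simp_thms)
qed

end

lemma height_copy:
  assumes "i < n"
  shows "height n (Suc k) (copy_vert (b, i) u) = (if b then 1 - height n k u / 2 else height n k u / 2)"
proof -
  interpret refined_cut n k .
  show ?thesis
    unfolding height_def[of n "Suc k"] prob_cut_pmf_Suc cut_join
    using prob_active[OF assms] by (cases b) (simp_all add: prob_Not)
qed

text \<open>The pair is separated exactly when its copy is cut, which has probability 1/2, and the
  independent cut inside the copy separates it.\<close>

lemma sep_same_copy: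
  assumes "i < n"
  shows "sep n (Suc k) (copy_vert (b, i) u) (copy_vert (b, i) v) = sep n k u v / 2"
proof -
  interpret refined_cut n k .
  have "{z. (b \<noteq> active b i u z) \<noteq> (b \<noteq> active b i v z)} =
      {A. b \<noteq> (i \<in> A)} \<times> {c. c (b, i) \<in> {\<omega>. cut \<omega> u \<noteq> cut \<omega> v}}"
    by (auto simp: active_def)
  then show ?thesis
    using assms prob_mem[OF assms, of b]
      prob_Pi_pmf_one[OF finite_index, of "(b, i)" _ _ "{\<omega>. cut \<omega> u \<noteq> cut \<omega> v}"]
    by (simp only: sep_def prob_cut_pmf_Suc cut_join prob_pair_pmf_Times copies_pmf_def) simp
qed

text \<open>The terminals are always separated, so this is the probability that exactly one of the
  two points is active, or its complement when \<open>b \<noteq> b'\<close>. For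
  \<open>i = j\<close> exactly one of the two copies is cut, so the points are never active
  together.\<close>

lemma sep_different_copies:
  fixes n k :: nat and u v :: "(bool + nat, bool \<times> nat) pvert"
  assumes "i < n" "j < n" "(b, i) \<noteq> (b', j)"
  defines "m \<equiv> (n + 1) div 2" and "x \<equiv> height n k u / 2" and "y \<equiv> height n k v / 2"
  shows "sep n (Suc k) (copy_vert (b, i) u) (copy_vert (b', j) v) =
    (if i = j then 1 - x - y
     else if b = b' then x + y - 4 * (real m - 1) / (2 * real m - 1) * (x * y)
     else 1 - x - y + 4 * real m / (2 * real m - 1) * (x * y))"
proof -
  interpret refined_cut n k .
  let ?M = "pair_pmf halves_pmf copies_pmf"
  let ?q = "measure_pmf.prob halves_pmf {A. b \<noteq> (i \<in> A) \<and> b' \<noteq> (j \<in> A)}"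
  have m: "m \<ge> 1" using assms by (auto simp: m_def)
  \<comment> \<open>In the factor 8, inclusion-exclusion contributes 2, and the heights
    \<open>2 * x\<close> and \<open>2 * y\<close> contribute 4.\<close>
  have xor: "measure_pmf.prob ?M {z. active b i u z \<noteq> active b' j v z} = x + y - 8 * ?q * (x * y)"
    unfolding prob_xor using assms by (simp add: prob_active prob_active_both)
  have sep: "sep n (Suc k) (copy_vert (b, i) u) (copy_vert (b', j) v) =
      (if b = b' then x + y - 8 * ?q * (x * y) else 1 - (x + y - 8 * ?q * (x * y)))"
  proof (cases "b = b'")
    case True
    then have "{z. (b \<noteq> active b i u z) \<noteq> (b' \<noteq> active b' j v z)} = {z. active b i u z \<noteq> active b' j v z}"
      by auto
    then show ?thesis unfolding sep_def prob_cut_pmf_Suc cut_join using xor True by simp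
  next
    case False
    then have "{z. (b \<noteq> active b i u z) \<noteq> (b' \<noteq> active b' j v z)} = {z. \<not> (active b i u z \<noteq> active b' j v z)}"
      by auto
    then show ?thesis unfolding sep_def prob_cut_pmf_Suc cut_join
      using xor False by (simp only: prob_Not if_False)
  qed
  show ?thesis
  proof (cases "i = j")
    case True
    then have "b \<noteq> b'" using assms by auto
    then have "{A. b \<noteq> (i \<in> A) \<and> b' \<noteq> (j \<in> A)} = {}" using True by auto
    then show ?thesis using sep True \<open>b \<noteq> b'\<close> by (simp only: measure_empty) simp
  next
    case False
    have "?q = (if b = b' then 1 / 2 - real m / (2 * (2 * real m - 1)) else real m / (2 * (2 * real m - 1)))"
      using prob_mem_both[OF assms(1,2) False] by (simp add: m_def)
    moreover have "8 * (1 / 2 - real m / (2 * (2 * real m - 1))) = 4 * (real m - 1) / (2 * real m - 1)"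
      using m by (simp add: field_simps)
    moreover have "8 * (real m / (2 * (2 * real m - 1))) = 4 * real m / (2 * real m - 1)"
      using m by (simp add: field_simps)
    ultimately have "8 * ?q = (if b = b' then 4 * (real m - 1) / (2 * real m - 1) else 4 * real m / (2 * real m - 1))"
      by presburger
    then show ?thesis unfolding sep by (simp only: False if_False) simp
  qed
qed

section \<open>The distortion bound\<close>

lemma walk_Kpow_0: "walk (Kpow n 0) Src 1 Snk"
proof -
  have "walk (Kpow n 0) Snk 0 Snk" by (auto intro: walk.nil simp: verts_Kpow_0)
  then show ?thesis
    using walk.fwd[of "[]" "Kpow n 0" 0 Snk] by (simp add: oslash_pow.simps single_edge_def)
qed

text \<open>A point reaches the terminal of its top-level copy inside that copy, and the opposite
  terminal through the midpoint. Thus \<open>height\<close> also measures the position along a walk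
  of length 1 from source to sink.\<close>

lemma height_walks:
  assumes "n \<ge> 1" "u \<in> verts (Kpow n k)"
  shows "walk (Kpow n k) (src (Kpow n k)) (height n k u) u \<and>
    walk (Kpow n k) u (1 - height n k u) (snk (Kpow n k))"
  using assms(2)
proof (induction k arbitrary: u)
  case 0
  have "walk (Kpow n 0) Src 0 Src" "walk (Kpow n 0) Snk 0 Snk"
    by (auto intro: walk.nil simp: verts_Kpow_0)
  moreover have "walk (Kpow n 0) Src 1 Snk" by (rule walk_Kpow_0)
  ultimately show ?case using 0 by (auto simp: verts_Kpow_0 src_snk_Kpow_0 height_def)
next
  case (Suc k)
  from verts_Kpow_SucE[OF assms(1) Suc.prems] obtain b i u'
    where u: "u = copy_vert (b, i) u'" "u' \<in> verts (Kpow n k)" "i < n" .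
  note IH = Suc.IH[OF u(2)]
  let ?h = "height n k u'" and ?T = "\<lambda>b. (if b then snk else src) (Kpow n (Suc k))"
  have "walk (Kpow n k) (src (Kpow n k)) 1 (snk (Kpow n k))"
    using walk_trans[OF IH[THEN conjunct1] IH[THEN conjunct2]] by simp
  \<comment> \<open>The companion copy \<open>(\<not> b, i)\<close> links the opposite terminal to
    the same midpoint.\<close>
  from walk_copy_vert[OF assms(1) u(3) this, of "\<not> b"]
  have far: "walk (Kpow n (Suc k)) (?T (\<not> b)) (1 / 2) (copy_vert (b, i) (snk (Kpow n k)))"
    unfolding copy_vert_src copy_vert_snk[of "\<not> b" i n k b] .
  from walk_copy_vert[OF assms(1) u(3) IH[THEN conjunct1], of b]
  have 1: "walk (Kpow n (Suc k)) (?T b) (?h / 2) u"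
    unfolding copy_vert_src u(1) .
  from walk_copy_vert[OF assms(1) u(3) IH[THEN conjunct2], of b]
  have 2: "walk (Kpow n (Suc k)) u ((1 - ?h) / 2) (copy_vert (b, i) (snk (Kpow n k)))"
    unfolding u(1) .
  have 3: "walk (Kpow n (Suc k)) u (1 - ?h / 2) (?T (\<not> b))"
    using walk_trans[OF 2 walk_sym_Kpow[OF far]] by (simp add: field_simps)
  show ?case
    using 1 3 walk_sym_Kpow[OF 1] walk_sym_Kpow[OF 3]
    by (cases b) (simp_all add: u height_copy)
qed

text \<open>From \<open>x, y \<le> 1/2\<close> follows \<open>4 * (x * y) \<le> x + y\<close>, so at
  least the fraction \<open>m / (2 * m - 1)\<close> of \<open>x + y\<close> survives; it is at least
  \<open>(2 * m + 1) / (4 * m)\<close> because \<open>4 * m^2 \<ge> 4 * m^2 - 1\<close>.\<close>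

lemma same_side_ineq:
  fixes x y m :: real
  assumes "m \<ge> 1" "0 \<le> x" "x \<le> 1 / 2" "0 \<le> y" "y \<le> 1 / 2"
  shows "(2 * m + 1) / (4 * m) * (x + y) \<le> x + y - 4 * (m - 1) / (2 * m - 1) * (x * y)"
proof -
  have "x * y \<le> x * (1 / 2)" "x * y \<le> (1 / 2) * y"
    using assms by (intro mult_left_mono mult_right_mono; simp)+
  then have "4 * (x * y) \<le> x + y" by simp
  then have "(m - 1) / (2 * m - 1) * (4 * (x * y)) \<le> (m - 1) / (2 * m - 1) * (x + y)"
    using assms by (intro mult_left_mono divide_nonneg_nonneg) auto
  moreover have "4 * (m - 1) / (2 * m - 1) * (x * y) = (m - 1) / (2 * m - 1) * (4 * (x * y))"
    by simp
  moreover have "(2 * m + 1) / (4 * m) \<le> 1 - (m - 1) / (2 * m - 1)"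
    using assms by (simp add: field_simps)
  from mult_right_mono[OF this, of "x + y"] assms
  have "(2 * m + 1) / (4 * m) * (x + y) \<le> (x + y) - (m - 1) / (2 * m - 1) * (x + y)"
    by (simp add: algebra_simps)
  ultimately show ?thesis by linarith
qed

text \<open>This case determines the constant: equality holds at
  \<open>x = y = (2 * m - 1) / (4 * m)\<close>.\<close>

lemma opposite_side_ineq:
  fixes x y m :: real
  assumes "m \<ge> 1" "0 \<le> y" "y \<le> x" "x \<le> 1 / 2"
  shows "(2 * m + 1) / (4 * m) * (1 - x + y) \<le> 1 - x - y + 4 * m / (2 * m - 1) * (x * y)"
proof (cases "x = 0")
  \<comment> \<open>The main argument divides by \<open>x\<close>; here \<open>x = 0\<close> forces
    \<open>y = 0\<close>.\<close>
  case True
  then show ?thesis using assms by (simp add: field_simps)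
next
  case False
  define b where "b = 4 * m / (2 * m - 1)"
  have b: "b > 0" using assms by (simp add: b_def)
  have C: "(2 * m + 1) / (4 * m) = 1 - 1 / b"
    using assms by (simp add: b_def field_simps)
  define D where "D = 1 - x - y + b * (x * y) - (1 - 1 / b) * (1 - x + y)"
  \<comment> \<open>\<open>D\<close> is affine in \<open>y\<close>: interpolate between \<open>y = 0\<close> and \<open>y = x\<close>.\<close>
  have "(x * b) * D = (x - y) * (1 - x) + y * (1 - b * x)\<^sup>2"
  proof -
    have "b * (1 / b) = 1" using b by simp
    then show ?thesis unfolding D_def by algebra
  qed
  also have "\<dots> \<ge> 0" using assms by (intro add_nonneg_nonneg mult_nonneg_nonneg) auto
  finally have "D \<ge> 0" using mult_pos_pos[of x b] b False assms by (simp add: zero_le_mult_iff del: mult_pos_pos)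
  then show ?thesis unfolding C D_def b_def by simp
qed

text \<open>One explicit walk suffices, since its length bounds the distance from above. Induction
  on \<open>k\<close>: pairs inside one copy scale down, and pairs in different copies are settled
  by their heights alone.\<close>

lemma walk_le_sep:
  fixes n k :: nat
  assumes "n \<ge> 1" "u \<in> verts (Kpow n k)" "v \<in> verts (Kpow n k)"
  defines "m \<equiv> (n + 1) div 2"
  shows "\<exists>l. walk (Kpow n k) u l v \<and> (2 * real m + 1) / (4 * real m) * l \<le> sep n k u v"
  using assms(2,3)
proof (induction k arbitrary: u v)
  case 0
  have m: "m \<ge> 1" using assms(1) by (simp add: m_def)
  have "walk (Kpow n 0) Src 0 Src" "walk (Kpow n 0) Snk 0 Snk"
    by (auto intro: walk.nil simp: verts_Kpow_0)
  moreover have "walk (Kpow n 0) Src 1 Snk" by (rule walk_Kpow_0)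
  moreover from walk_sym_Kpow[OF this] have "walk (Kpow n 0) Snk 1 Src" .
  moreover have "sep n 0 Src Snk = 1" "sep n 0 Snk Src = 1"
    by (simp_all add: sep_def)
  moreover have "(2 * real m + 1) / (4 * real m) \<le> 1"
    using m by (simp add: field_simps)
  moreover have "u = v \<or> u = Src \<and> v = Snk \<or> u = Snk \<and> v = Src" "u = Src \<or> u = Snk"
    using 0 by (auto simp: verts_Kpow_0)
  ultimately show ?case
    by (metis mult_1_right mult_zero_right order_refl sep_refl)
next
  case (Suc k)
  let ?C = "(2 * real m + 1) / (4 * real m)" and ?G = "Kpow n (Suc k)"
  have m: "real m \<ge> 1" using assms(1) by (auto simp: m_def)
  from verts_Kpow_SucE[OF assms(1) Suc.prems(1)] obtain b i u'
    where u: "u = copy_vert (b, i) u'" "u' \<in> verts (Kpow n k)" "i < n" .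
  from verts_Kpow_SucE[OF assms(1) Suc.prems(2)] obtain b' j v'
    where v: "v = copy_vert (b', j) v'" "v' \<in> verts (Kpow n k)" "j < n" .
  define x where "x = height n k u' / 2"
  define y where "y = height n k v' / 2"
  have xy: "0 \<le> x" "x \<le> 1 / 2" "0 \<le> y" "y \<le> 1 / 2"
    using height_bounds[of n k] by (auto simp: x_def y_def)
  define T where "T b = (if b then snk else src) ?G" for b :: bool
  \<comment> \<open>Both copies with index \<open>i\<close> share this vertex; \<open>False\<close>
    is an arbitrary representative.\<close>
  define mid where "mid i = copy_vert (False, i) (snk (Kpow n k))" for i
  have half: "walk ?G (T b) (1 / 2) (mid i)" if "i < n" for b i
  proof -
    have "walk (Kpow n k) (src (Kpow n k)) 1 (snk (Kpow n k))"
      using walk_trans[OF height_walks[OF assms(1) u(2), THEN conjunct1]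
        height_walks[OF assms(1) u(2), THEN conjunct2]] by simp
    from walk_copy_vert[OF assms(1) that this, of b] show ?thesis
      unfolding copy_vert_src T_def mid_def copy_vert_snk[of b i n k False] .
  qed
  have near: "walk ?G (T b) (height n k w / 2) (copy_vert (b, i) w)"
    "walk ?G (mid i) (1 / 2 - height n k w / 2) (copy_vert (b, i) w)"
    if "w \<in> verts (Kpow n k)" "i < n" for w b i
  proof -
    from walk_copy_vert[OF assms(1) that(2) height_walks[OF assms(1) that(1), THEN conjunct1], of b]
    show "walk ?G (T b) (height n k w / 2) (copy_vert (b, i) w)"
      unfolding copy_vert_src T_def .
    from walk_copy_vert[OF assms(1) that(2) height_walks[OF assms(1) that(1), THEN conjunct2], of b]
    show "walk ?G (mid i) (1 / 2 - height n k w / 2) (copy_vert (b, i) w)"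
      unfolding mid_def copy_vert_snk[of b i n k False] diff_divide_distrib by (rule walk_sym_Kpow)
  qed
  have u_near: "walk ?G u x (T b)" "walk ?G u (1 / 2 - x) (mid i)"
    using near[OF u(2,3), of b, THEN walk_sym_Kpow] by (simp_all add: u(1) x_def)
  have v_near: "walk ?G (T b') y v" "walk ?G (mid j) (1 / 2 - y) v"
    using near[OF v(2,3), of b'] by (auto simp: v(1) y_def)
  show ?case
  proof (cases "(b, i) = (b', j)")
    case True
    from Suc.IH[OF u(2) v(2)] obtain l
      where l: "walk (Kpow n k) u' l v'" "?C * l \<le> sep n k u' v'" by blast
    from walk_copy_vert[OF assms(1) u(3) l(1), of b] have "walk ?G u (l / 2) v"
      using True by (simp add: u(1) v(1))
    moreover have "?C * (l / 2) \<le> sep n (Suc k) u v"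
      using l(2) sep_same_copy[OF u(3), of k b u' v'] True by (simp add: u(1) v(1))
    ultimately show ?thesis by blast
  next
    case False
    note sep = sep_different_copies[OF u(3) v(3) False, of k u' v',
      folded m_def x_def y_def u(1) v(1)]
    \<comment> \<open>The walk uses the common midpoint, the common terminal, or, for different
      paths and opposite terminals, the shorter of two ways around.\<close>
    consider "i = j" "b \<noteq> b'" | "i \<noteq> j" "b = b'" | "i \<noteq> j" "b \<noteq> b'" "y \<le> x" | "i \<noteq> j" "b \<noteq> b'" "x \<le> y"
      using False linear[of x y] by blast
    then show ?thesis
    proof cases
      case 1
      from walk_trans[OF u_near(2), of "1 / 2 - y" v] v_near(2) 1
      have "walk ?G u (1 - x - y) v" by (simp add: algebra_simps)
      moreover have "?C * (1 - x - y) \<le> 1 * (1 - x - y)"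
        using m xy by (intro mult_right_mono) (auto simp: field_simps)
      ultimately show ?thesis using sep 1 by auto
    next
      case 2
      from walk_trans[OF u_near(1), of y v] v_near(1) 2
      have "walk ?G u (x + y) v" by simp
      moreover have "?C * (x + y) \<le> sep n (Suc k) u v"
        using same_side_ineq[OF m xy] sep 2 m by (simp add: of_nat_diff)
      ultimately show ?thesis by blast
    next
      case 3
      \<comment> \<open>From \<open>u\<close> through its own midpoint to the terminal of
        \<open>v\<close>, of length \<open>(1/2 - x) + 1/2 + y\<close>. The case
        \<open>x \<le> y\<close> leaves through the terminal of \<open>u\<close> instead.\<close>
      from walk_trans[OF walk_trans[OF u_near(2) walk_sym_Kpow[OF half[OF u(3)]]] v_near(1)]
      have "walk ?G u (1 - x + y) v" by (simp add: algebra_simps)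
      moreover have "?C * (1 - x + y) \<le> sep n (Suc k) u v"
        using opposite_side_ineq[OF m xy(3) 3(3) xy(2)] sep 3 by simp
      ultimately show ?thesis by blast
    next
      case 4
      from walk_trans[OF walk_trans[OF u_near(1) half[OF v(3)]] v_near(2)]
      have "walk ?G u (1 - y + x) v" by (simp add: algebra_simps)
      moreover have "?C * (1 - y + x) \<le> sep n (Suc k) u v"
        using opposite_side_ineq[OF m xy(1) 4(3) xy(4)] sep 4 by (simp add: mult.commute algebra_simps)
      ultimately show ?thesis by blast
    qed
  qed
qed

text \<open>By \<open>sep_same_copy\<close> every level halves the separation, which is 1 on the
  single edge.\<close>

lemma sep_edge:
  assumes "e \<in> edges (Kpow n k)"
  shows "sep n k (tail (Kpow n k) e) (head (Kpow n k) e) = 1 / 2 ^ k"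
  using assms
proof (induction k arbitrary: e)
  case 0
  then show ?case by (simp add: oslash_pow.simps single_edge_def sep_def)
next
  case (Suc k)
  then obtain e' a where e: "e = e' @ [a]" "e' \<in> edges (Kpow n k)" "a \<in> UNIV \<times> {..<n}"
    by (elim edges_Kpow_SucE)
  then show ?case
    using Suc.IH[OF e(2)] tail_head_Kpow_append[OF e(2), of a]
    by (cases a) (auto simp: sep_same_copy)
qed

lemma sep_le_walk:
  assumes "n \<ge> 1" "walk (Kpow n k) u l v"
  shows "sep n k u v \<le> l"
proof (rule walk_len_ge_pseudometric[OF assms(2)])
  show "sep n k (tail (Kpow n k) e) (head (Kpow n k) e) \<le> len (Kpow n k) e" if "e \<in> edges (Kpow n k)" for e
    using sep_edge[OF that] len_K2_pow[OF assms(1) that] by simp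
qed (fact sep_refl sep_sym sep_triangle)+

section \<open>Realization in \<open>L1\<close>\<close>

lemma ex_L1_finite_sum:
  fixes g :: "'j \<Rightarrow> 'v \<Rightarrow> real" and w :: "'j \<Rightarrow> real"
  assumes "finite J" "J \<noteq> {}" "\<And>j. j \<in> J \<Longrightarrow> w j \<ge> 0"
  shows "\<exists>F :: 'v \<Rightarrow> L1. \<forall>p q. dist (F p) (F q) = (\<Sum>j\<in>J. w j * \<bar>g j p - g j q\<bar>)"
proof -
  define N where "N = card J"
  have N: "N > 0" using assms by (simp add: N_def card_gt_0_iff)
  obtain h where h: "bij_betw h {0..<N} J"
    using ex_bij_betw_nat_finite[OF assms(1)] by (auto simp: N_def)
  \<comment> \<open>One interval of length \<open>1 / N\<close> for each element of
    \<open>J\<close>, half-open so that they are disjoint.\<close>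
  define B :: "nat \<Rightarrow> real set" where "B r = {r / N..<(r + 1) / N}" for r
  have B_sub: "B r \<subseteq> {0..1}" if "r < N" for r
  proof -
    have "(real r + 1) / N \<le> 1" using that N by simp
    moreover have "0 \<le> real r / N" by simp
    ultimately show ?thesis unfolding B_def by (meson atLeastLessThan_subseteq_atLeastAtMost_iff)
  qed
  have B_sets: "B r \<in> sets unit_leb" if "r < N" for r
    using B_sub[OF that] by (auto simp: sets_restrict_space_iff B_def)
  have B_measure: "measure unit_leb (B r) = 1 / N" if "r < N" for r
  proof -
    have "measure unit_leb (B r) = measure lebesgue (B r)"
      using B_sub[OF that] by (intro measure_restrict_space) auto
    also have "\<dots> = (real r + 1) / N - r / N"
      unfolding B_def using N by (simp add: divide_right_mono)
    finally show ?thesis by (simp add: diff_divide_distrib[symmetric])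
  qed
  have B_finite: "emeasure unit_leb (B r) < \<infinity>" if "r < N" for r
  proof -
    have "emeasure unit_leb (B r) = emeasure lebesgue (B r)"
      using B_sub[OF that] by (intro emeasure_restrict_space) auto
    also have "\<dots> < \<infinity>"
      unfolding B_def using N by (simp add: divide_right_mono)
    finally show ?thesis .
  qed
  have B_disj: "r = s" if "t \<in> B r" "t \<in> B s" for r s t
  proof -
    have "real r \<le> t * N" "t * N < real r + 1" "real s \<le> t * N" "t * N < real s + 1"
      using that N by (auto simp: B_def field_simps)
    then show "r = s" by linarith
  qed
  define S where "S c t = (\<Sum>r<N. c r * indicat_real (B r) t)" for c :: "nat \<Rightarrow> real" and t
  have S_int: "integrable unit_leb (S c)" for c
    unfolding S_def
    by (intro Bochner_Integration.integrable_sum integrable_mult_right integrable_real_indicator)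
      (use B_sets B_finite in auto)
  have S_integral: "(\<integral>t. S c t \<partial>unit_leb) = (\<Sum>r<N. c r * measure unit_leb (B r))" for c
  proof -
    have "(\<integral>t. S c t \<partial>unit_leb) = (\<Sum>r<N. \<integral>t. c r * indicat_real (B r) t \<partial>unit_leb)"
      unfolding S_def
      by (intro Bochner_Integration.integral_sum integrable_mult_right integrable_real_indicator)
        (use B_sets B_finite in auto)
    also have "\<dots> = (\<Sum>r<N. c r * measure unit_leb (B r))"
      using B_sub by (intro sum.cong) (auto simp: space_restrict_space Int_absorb2)
    finally show ?thesis .
  qed
  \<comment> \<open>At each point at most one summand is nonzero, so the absolute value passes to
    the coefficients.\<close>
  have S_abs: "\<bar>S c t\<bar> = S (\<lambda>r. \<bar>c r\<bar>) t" for c t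
  proof (cases "\<exists>r<N. t \<in> B r")
    case True
    then obtain r where r: "r < N" "t \<in> B r" by blast
    have "S c t = c r" for c
    proof -
      have "S c t = (\<Sum>s<N. if s = r then c s else 0)"
        unfolding S_def using B_disj r(2) by (intro sum.cong) (auto simp: indicator_def)
      then show ?thesis using r(1) by simp
    qed
    then show ?thesis by simp
  next
    case False
    then show ?thesis by (auto simp: S_def)
  qed
  \<comment> \<open>The factor \<open>N\<close> compensates for the interval length
    \<open>1 / N\<close>.\<close>
  define f where "f p = S (\<lambda>r. N * (w (h r) * g (h r) p))" for p
  have f_int: "L1_rel (f p) (f p)" for p
    by (simp add: L1_rel_def f_def S_int)
  have "dist (abs_L1 (f p)) (abs_L1 (f q)) = (\<Sum>j\<in>J. w j * \<bar>g j p - g j q\<bar>)" for p q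
  proof -
    have diff: "f p t - f q t = S (\<lambda>r. N * (w (h r) * (g (h r) p - g (h r) q))) t" for t
      by (simp add: f_def S_def sum_subtractf[symmetric] algebra_simps)
    have "dist (abs_L1 (f p)) (abs_L1 (f q)) = (\<integral>t. \<bar>f p t - f q t\<bar> \<partial>unit_leb)"
      by (rule dist_L1.abs_eq) (rule f_int)+
    also have "\<dots> = (\<integral>t. S (\<lambda>r. \<bar>N * (w (h r) * (g (h r) p - g (h r) q))\<bar>) t \<partial>unit_leb)"
      by (simp only: diff S_abs)
    also have "\<dots> = (\<Sum>r<N. \<bar>N * (w (h r) * (g (h r) p - g (h r) q))\<bar> * measure unit_leb (B r))"
      by (rule S_integral)
    also have "\<dots> = (\<Sum>r<N. \<bar>w (h r) * (g (h r) p - g (h r) q)\<bar>)"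
      using N by (intro sum.cong) (auto simp: B_measure abs_mult)
    also have "\<dots> = (\<Sum>j\<in>J. \<bar>w j * (g j p - g j q)\<bar>)"
      using sum.reindex_bij_betw[OF h, of "\<lambda>j. \<bar>w j * (g j p - g j q)\<bar>"] by (simp add: atLeast0LessThan)
    also have "\<dots> = (\<Sum>j\<in>J. w j * \<bar>g j p - g j q\<bar>)"
      using assms(3) by (intro sum.cong) (auto simp: abs_mult)
    finally show ?thesis .
  qed
  then show ?thesis by (intro exI[of _ "\<lambda>p. abs_L1 (f p)"]) blast
qed

text \<open>The finite support of \<open>cut_pmf\<close> makes \<open>sep\<close> a finite sum of
  cut semimetrics, weighted by the probabilities of the cuts.\<close>

lemma ex_L1_sep: "\<exists>F :: _ \<Rightarrow> L1. \<forall>u v. dist (F u) (F v) = sep n k u v"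
proof -
  let ?J = "set_pmf (cut_pmf n k)"
  have "sep n k u v = (\<Sum>\<omega>\<in>?J. pmf (cut_pmf n k) \<omega> * \<bar>of_bool (cut \<omega> u) - of_bool (cut \<omega> v)\<bar>)" for u v
  proof -
    have "sep n k u v = measure_pmf.prob (cut_pmf n k) ({\<omega>. cut \<omega> u \<noteq> cut \<omega> v} \<inter> ?J)"
      by (simp add: sep_def measure_Int_set_pmf)
    also have "\<dots> = (\<Sum>\<omega>\<in>{\<omega>. cut \<omega> u \<noteq> cut \<omega> v} \<inter> ?J. pmf (cut_pmf n k) \<omega>)"
      by (intro measure_measure_pmf_finite) (simp add: finite_set_cut_pmf)
    also have "\<dots> = (\<Sum>\<omega>\<in>?J. pmf (cut_pmf n k) \<omega> * \<bar>of_bool (cut \<omega> u) - of_bool (cut \<omega> v)\<bar>)"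
      by (intro sum.mono_neutral_cong_left) (auto simp: finite_set_cut_pmf)
    finally show ?thesis .
  qed
  then show ?thesis
    using ex_L1_finite_sum[of ?J "pmf (cut_pmf n k)" "\<lambda>\<omega> u. of_bool (cut \<omega> u)"]
    by (simp add: finite_set_cut_pmf set_pmf_not_empty)
qed

text \<open>Equal images would force distance at most 0 by \<open>lower\<close>, against
  \<open>pos\<close>, so \<open>f\<close> is injective. Then \<open>upper\<close> bounds its
  Lipschitz constant by 1, and \<open>lower\<close> bounds that of the inverse by
  \<open>D\<close>.\<close>

lemma distortion_le:
  assumes pos: "\<And>x y. x \<in> X \<Longrightarrow> y \<in> X \<Longrightarrow> x \<noteq> y \<Longrightarrow> 0 < dX x y"
    and upper: "\<And>x y. x \<in> X \<Longrightarrow> y \<in> X \<Longrightarrow> dist (f x) (f y) \<le> dX x y"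
    and lower: "\<And>x y. x \<in> X \<Longrightarrow> y \<in> X \<Longrightarrow> dX x y \<le> D * dist (f x) (f y)"
    and D: "D \<ge> 0"
  shows "distortion X dX dist f \<le> ennreal D"
proof -
  have inj: "inj_on f X"
  proof (rule inj_onI, rule ccontr)
    fix x y assume "x \<in> X" "y \<in> X" "f x = f y" "x \<noteq> y"
    then show False using pos[of x y] lower[of x y] by simp
  qed
  have "lip_const X dX dist f \<le> 1"
    unfolding lip_const_def
  proof (rule SUP_least, clarify)
    fix x y assume "x \<in> X" "y \<in> X" "x \<noteq> y"
    then have "dist (f x) (f y) / dX x y \<le> 1" using pos upper by simp
    then show "ennreal (dist (f x) (f y) / dX x y) \<le> 1" by (simp add: ennreal_le_1)
  qed
  moreover have "lip_const (f ` X) dist dX (inv_into X f) \<le> ennreal D"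
    unfolding lip_const_def
  proof (rule SUP_least, clarify)
    fix x y assume "x \<in> X" "y \<in> X" "f x \<noteq> f y"
    then have "dX x y / dist (f x) (f y) \<le> D" using lower by (simp add: divide_le_eq)
    then show "ennreal (dX (inv_into X f (f x)) (inv_into X f (f y)) / dist (f x) (f y)) \<le> ennreal D"
      using inj \<open>x \<in> X\<close> \<open>y \<in> X\<close> by (simp add: ennreal_leI)
  qed
  ultimately have "lip_const X dX dist f * lip_const (f ` X) dist dX (inv_into X f) \<le> 1 * ennreal D"
    by (rule mult_mono) auto
  then show ?thesis using inj by (simp add: distortion_def)
qed

theorem theorem5p1:
  fixes n k :: nat
  assumes "n \<ge> 1" and "k \<ge> 1"
  shows "c1 (verts (oslash_pow (K2 n) k)) (sp_dist (oslash_pow (K2 n) k))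
           \<le> ennreal (2 - 2 / (2 * real_of_int \<lceil>real n / 2\<rceil> + 1))"
proof -
  define m where "m = (n + 1) div 2"
  have m: "real m \<ge> 1" using assms(1) by (auto simp: m_def)
  have "\<lceil>real n / 2\<rceil> = int m"
    unfolding m_def by (rule ceiling_unique; cases "even n") (auto elim!: evenE oddE)
  \<comment> \<open>The bound is the reciprocal of the factor in \<open>walk_le_sep\<close>.\<close>
  then have D: "2 - 2 / (2 * real_of_int \<lceil>real n / 2\<rceil> + 1) = 4 * real m / (2 * real m + 1)"
    using m by (simp add: field_simps)
  obtain F :: "_ \<Rightarrow> L1" where F: "dist (F u) (F v) = sep n k u v" for u v
    using ex_L1_sep by blast
  let ?V = "verts (Kpow n k)" and ?d = "sp_dist (Kpow n k)"
  have walk_ge: "l \<ge> 0 \<and> (u \<noteq> v \<longrightarrow> l \<ge> 1 / 2 ^ k)" if "walk (Kpow n k) u l v" for u l v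
    by (rule walk_len_ge[OF that]) (use len_K2_pow[OF assms(1)] in auto)
  \<comment> \<open>The infimum defining \<open>sp_dist\<close> ranges over a nonempty set, as is
    needed to bound it from below.\<close>
  have ex: "\<exists>l. l \<in> {l. walk (Kpow n k) u l v}" if "u \<in> ?V" "v \<in> ?V" for u v
    using walk_le_sep[OF assms(1) that] by blast
  have "distortion ?V ?d dist F \<le> ennreal (4 * real m / (2 * real m + 1))"
  proof (rule distortion_le)
    fix u v assume uv: "u \<in> ?V" "v \<in> ?V"
    show "dist (F u) (F v) \<le> ?d u v"
      unfolding F sp_dist_def
      using ex[OF uv] by (intro cInf_greatest) (auto intro: sep_le_walk[OF assms(1)])
    obtain l where l: "walk (Kpow n k) u l v" "(2 * real m + 1) / (4 * real m) * l \<le> sep n k u v"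
      using walk_le_sep[OF assms(1) uv] by (auto simp: m_def)
    have "?d u v \<le> l"
      unfolding sp_dist_def using l(1) walk_ge by (intro cInf_lower bdd_belowI[of _ 0]) auto
    also have "l \<le> 4 * real m / (2 * real m + 1) * sep n k u v"
      using l(2) m by (simp add: field_simps)
    finally show "?d u v \<le> 4 * real m / (2 * real m + 1) * dist (F u) (F v)"
      by (simp add: F)
    assume "u \<noteq> v"
    then have "1 / 2 ^ k \<le> ?d u v"
      unfolding sp_dist_def using ex[OF uv] walk_ge by (intro cInf_greatest) auto
    then show "0 < ?d u v" by (rule less_le_trans[rotated]) simp
  qed simp
  then show ?thesis
    unfolding D c1_def by (rule Inf_lower2[OF rangeI[of _ F]])
qed

end
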